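(* Let $n\ge4$ be an even positive integer and $0\le k<n/2$. Let $\phi=(\phi_1,\ldots,\phi_{n/2-k})$ be a mapping from $\mathbb{F}_2^{n/2+k}$ to $\mathbb{F}_2^{n/2-k}$ such that $c\cdot\phi$ is a balanced function for any nonzero $c\in\mathbb{F}_2^{n/2-k}$. For a Boolean function $g$ on $\mathbb{F}_2^{n/2+k}$ and a nonzero $a\in\mathbb{F}_2^{n/2+k}$, denote $L^{(D_ag)}=\{v\in\mathbb{F}_2^{n/2+k}\mid D_vD_ag\text{ is constant}\}$. If for any nonzero $a\in\mathbb{F}_2^{n/2+k}$ we have $$\bigcap_{i=1}^{n/2-k}L^{(D_a\phi_i)}=\{0_{n/2+k},a\},$$ then $\phi$ satisfies property $(P_1^* )$, i.e., $D_vD_w\phi\neq0_{n/2-k}$ (as a function, that is, it is not identically zero) for all linearly independent $v,w\in\mathbb{F}_2^{n/2+k}$.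
   Context: "$\cdot$" is the standard dot product over $\mathbb{F}_2$; $0_r$ is the zero vector of $\mathbb{F}_2^r$. For a (vectorial) function $F$ on $\mathbb{F}_2^r$, $D_aF(x)=F(x+a)+F(x)$ and $D_aD_bF(x)=F(x)+F(x+a)+F(x+b)+F(x+a+b)$. A Boolean function is balanced if it takes the values $0$ and $1$ equally often. *)

theory Defs
  imports "HOL-Analysis.Analysis" "HOL-Library.Z2"
begin

text \<open>The field with two elements is the type \<^typ>\<open>bit\<close>, and the space of vectors
  of length \<open>r\<close> over it is \<^typ>\<open>bit ^ 'm\<close> with \<open>CARD('m) = r\<close>.\<close>

definition dotp :: "bit ^ 'm \<Rightarrow> bit ^ 'm \<Rightarrow> bit" where
  "dotp x y = (\<Sum>i\<in>UNIV. x $ i * y $ i)"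

definition balanced :: "(bit ^ 'm \<Rightarrow> bit) \<Rightarrow> bool" where
  "balanced f \<longleftrightarrow> card {x. f x = 0} = card {x. f x = 1}"

text \<open>The derivative is polymorphic in the codomain, so that it covers both Boolean
  functions and vectorial ones.\<close>

definition Dv :: "bit ^ 'm \<Rightarrow> (bit ^ 'm \<Rightarrow> 'b::plus) \<Rightarrow> bit ^ 'm \<Rightarrow> 'b" where
  "Dv a F x = F (x + a) + F x"

text \<open>\<open>const_dirs (Dv a g)\<close> is the set usually written \<open>L\<close> with superscript \<open>(D\<^sub>a g)\<close>.\<close>

definition const_dirs :: "(bit ^ 'm \<Rightarrow> bit) \<Rightarrow> (bit ^ 'm) set" where
  "const_dirs h = {v. Dv v h constant_on UNIV}"

text \<open>The condition \<open>v \<noteq> w\<close> is needed because independence is a property of the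
  set \<open>{v, w}\<close>, which would be a singleton if \<open>v = w\<close>.\<close>

definition property_P1_star :: "(bit ^ 'm \<Rightarrow> bit ^ 'p) \<Rightarrow> bool" where
  "property_P1_star \<phi> \<longleftrightarrow>
     (\<forall>v w. v \<noteq> w \<and> vec.independent {v, w} \<longrightarrow> Dv v (Dv w \<phi>) \<noteq> (\<lambda>x. 0))"

end

theory Submission imports Defs begin

text \<open>Derivatives act coordinatewise, so if \<open>D_v D_w \<phi>\<close> vanishes
  identically, then every \<open>D_v D_w \<phi>_i\<close> is constant, with value 0. Thus
  \<open>v\<close> lies in the intersection of the sets of constant directions of the
  \<open>D_w \<phi>_i\<close>, which is \<open>{0, w}\<close>; linear independence of
  \<open>v\<close> and \<open>w\<close> excludes both values.\<close>

theorem theorem5p8: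
  fixes n k :: nat and \<phi> :: "bit ^ 'm \<Rightarrow> bit ^ 'p"
  assumes "even n" and "n \<ge> 4" and "k < n div 2"
    and "CARD('m) = n div 2 + k" and "CARD('p) = n div 2 - k"
    and "\<And>c. c \<noteq> 0 \<Longrightarrow> balanced (\<lambda>x. dotp c (\<phi> x))"
    and "\<And>a. a \<noteq> 0 \<Longrightarrow> (\<Inter>i. const_dirs (Dv a (\<lambda>x. \<phi> x $ i))) = {0, a}"
  shows "property_P1_star \<phi>"
  unfolding property_P1_star_def
proof (intro allI impI notI, elim conjE)
  fix v w :: "bit ^ 'm"
  assume "v \<noteq> w" and indep: "vec.independent {v, w}"
    and zero: "Dv v (Dv w \<phi>) = (\<lambda>x. 0)"
  \<comment> \<open>Here \<open>w \<noteq> 0\<close> lets the intersection hypothesis be used at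
    \<open>a = w\<close>, and \<open>v \<noteq> 0\<close> rules out one of the two elements left for
    \<open>v\<close>.\<close>
  have "v \<noteq> 0" "w \<noteq> 0"
    using vec.dependent_zero[of "{v, w}"] indep by auto
  have "Dv v (Dv w (\<lambda>x. \<phi> x $ i)) x = 0" for i x
  proof -
    have "Dv v (Dv w (\<lambda>x. \<phi> x $ i)) x = Dv v (Dv w \<phi>) x $ i"
      by (simp add: Dv_def)
    then show ?thesis
      by (simp add: zero)
  qed
  then have "v \<in> (\<Inter>i. const_dirs (Dv w (\<lambda>x. \<phi> x $ i)))"
    by (auto simp: const_dirs_def constant_on_def)
  then show False
    using assms(7)[OF \<open>w \<noteq> 0\<close>] \<open>v \<noteq> 0\<close> \<open>v \<noteq> w\<close> by auto
qed

end
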